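(* Let $\mathcal{M}(t)\subset\mathbb{R}^3$ be a material surface of $\dot x=v(x,t)$ over the time interval $[t_0,t_0+T]$. Then: (i) $\mathcal{M}(t)$ is a repelling hyperbolic LCS if and only if $\mathcal{M}(t_0)\subset U$ and $\xi_3(x_0)\perp T_{x_0}\mathcal{M}(t_0)$ holds for all $x_0\in\mathcal{M}(t_0)$. (ii) $\mathcal{M}(t)$ is an attracting hyperbolic LCS if and only if $\mathcal{M}(t_0)\subset U$ and $\xi_1(x_0)\perp T_{x_0}\mathcal{M}(t_0)$ holds for all $x_0\in\mathcal{M}(t_0)$. (iii) $\mathcal{M}(t)$ is a shear LCS if and only if $\mathcal{M}(t_0)\subset U$ and $n_\pm(x_0)\perp T_{x_0}\mathcal{M}(t_0)$ holds for all $x_0\in\mathcal{M}(t_0)$ for one choice of the sign $\pm$ in the vector field $$n_{\pm}(x_0)=\sqrt{\frac{\sqrt{\lambda_1(x_0)}}{\sqrt{\lambda_1(x_0)}+\sqrt{\lambda_3(x_0)}}}\,\xi_1(x_0)\pm\sqrt{\frac{\sqrt{\lambda_3(x_0)}}{\sqrt{\lambda_1(x_0)}+\sqrt{\lambda_3(x_0)}}}\,\xi_3(x_0).$$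
   Context: Setting: $\dot x=v(x,t)$, $x\in D\subset\mathbb{R}^3$, $D$ compact, $t\in[t_0,t_0+T]$, $v$ smooth. The flow map is $F_{t_0}^{t}(x_0)=x(t;t_0,x_0)$, where $x(t;t_0,x_0)$ is the trajectory starting from $x_0$ at time $t_0$. The Cauchy--Green strain tensor is $C_{t_0}^{t_0+T}(x_0)=[\nabla F_{t_0}^{t_0+T}(x_0)]^*\nabla F_{t_0}^{t_0+T}(x_0)$; its eigenvalues, in increasing order, are $\lambda_1(x_0),\lambda_2(x_0),\lambda_3(x_0)$, with corresponding orthonormal eigenvectors $\xi_1(x_0),\xi_2(x_0),\xi_3(x_0)$. The discussion is restricted to the set of initial conditions $U=\{x_0\in D: 0<\lambda_1(x_0)<\lambda_2(x_0)<\lambda_3(x_0)\}$. $T_{x_0}\mathcal{M}(t_0)$ is the tangent space of $\mathcal{M}(t_0)$ at $x_0$. Material surface: a family $\mathcal{M}(t)=F_{t_0}^t(\mathcal{M}(t_0))$, $t\in[t_0,t_0+T]$, with $\mathcal{M}(t_0)$ a smooth two-dimensional surface. For a unit normal $n_0$ to $\mathcal{M}(t_0)$ at $x_0$, the unit normal to $\mathcal{M}(t_0+T)$ along the trajectory from $x_0$ is $n_{t_0+T}(x_0)=\dfrac{[\nabla F_{t_0}^{t_0+T}(x_0)]^{-*}n_0}{|[\nabla F_{t_0}^{t_0+T}(x_0)]^{-*}n_0|}$, where $A^{-*}=(A^{-1})^*$. Normal repulsion: $\rho(x_0,n_0)=\langle n_{t_0+T}(x_0),\nabla F_{t_0}^{t_0+T}(x_0)n_0\rangle$.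 Tangential shear: $\sigma(x_0,n_0)=|\nabla F_{t_0}^{t_0+T}(x_0)n_0-\langle n_{t_0+T}(x_0),\nabla F_{t_0}^{t_0+T}(x_0)n_0\rangle n_{t_0+T}(x_0)|$. Definitions (over $[t_0,t_0+T]$; $n_0$ denotes a unit normal to $\mathcal{M}(t_0)$ at $x_0$). $\mathcal{M}(t)$ is a - repelling hyperbolic LCS (Lagrangian Coherent Structure) if for any $x_0\in\mathcal{M}(t_0)$ and any other material surface $\hat{\mathcal{M}}(t)$ with $x_0\in\hat{\mathcal{M}}(t_0)$ and with unit normal $\hat n_0\not\parallel n_0$ at $x_0$, one has $\rho(x_0,\hat n_0)<\rho(x_0,n_0)$ and $\rho(x_0,n_0)>1$; - attracting hyperbolic LCS if for any such $x_0$ and $\hat{\mathcal{M}}$, one has $\rho(x_0,\hat n_0)>\rho(x_0,n_0)$ and $\rho(x_0,n_0)<1$; - shear LCS if for any such $x_0$ and $\hat{\mathcal{M}}$, one has $\sigma(x_0,\hat n_0)\le\sigma(x_0,n_0)$.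
   Formalization: M(t0)⊂U is assumed throughout; (i) adds λ3>1 and (ii) adds λ1<1 on M(t0), as the "if" parts fail without them (e.g. v=-(3x1,2x2,x3)); in (iii) the sign may depend on x0, one sign being claimed only for connected M(t0) with continuous ξ1, ξ3. *)

theory Defs
  imports "HOL-Analysis.Analysis"
begin

section \<open>Smooth maps and smooth surfaces\<close>

fun Ck_on :: "nat \<Rightarrow> ('a::euclidean_space \<Rightarrow> 'b::real_normed_vector) \<Rightarrow> 'a set \<Rightarrow> bool" where
  "Ck_on 0 f S \<longleftrightarrow> continuous_on S f"
| "Ck_on (Suc k) f S \<longleftrightarrow>
     f differentiable_on S \<and> (\<forall>b\<in>Basis. Ck_on k (\<lambda>x. frechet_derivative f (at x) b) S)"

text \<open>\<open>frechet_derivative f (at x)\<close> is only meaningful in the interior, hence the openness requirement.\<close>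

definition smooth_on :: "'a::euclidean_space set \<Rightarrow> ('a \<Rightarrow> 'b::real_normed_vector) \<Rightarrow> bool" where
  "smooth_on S f \<longleftrightarrow> open S \<and> (\<forall>k. Ck_on k f S)"

text \<open>Embedded two-dimensional submanifolds of space without boundary, by slice charts.\<close>

definition smooth_surface :: "(real^3) set \<Rightarrow> bool" where
  "smooth_surface S \<longleftrightarrow>
     (\<forall>p\<in>S. \<exists>A B (\<phi> :: real^3 \<Rightarrow> real^3) (\<psi> :: real^3 \<Rightarrow> real^3).
        p \<in> A \<and> homeomorphism A B \<phi> \<psi> \<and> smooth_on A \<phi> \<and> smooth_on B \<psi> \<and>
        \<phi> ` (S \<inter> A) = {y\<in>B. y $ 3 = 0})"

text \<open>Velocities at \<open>p\<close> of curves in \<open>S\<close>; no regularity of the curve away from \<open>p\<close> is needed,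
  since for a smooth surface the smooth curves yield the same set of velocities.\<close>

definition tangent_space :: "(real^3) set \<Rightarrow> real^3 \<Rightarrow> (real^3) set" where
  "tangent_space S p =
     {w. \<exists>c \<epsilon>. 0 < \<epsilon> \<and> c 0 = p \<and> (\<forall>s\<in>{-\<epsilon><..<\<epsilon>}. c s \<in> S) \<and>
             (c has_vector_derivative w) (at (0::real))}"

definition perp_tangent :: "(real^3) set \<Rightarrow> real^3 \<Rightarrow> real^3 \<Rightarrow> bool" where
  "perp_tangent S p n \<longleftrightarrow> (\<forall>w\<in>tangent_space S p. orthogonal n w)"

definition unit_normal :: "(real^3) set \<Rightarrow> real^3 \<Rightarrow> real^3 \<Rightarrow> bool" where
  "unit_normal S p n \<longleftrightarrow> norm n = 1 \<and> perp_tangent S p n"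

section \<open>Flow map, strain tensor and material surfaces\<close>

text \<open>\<open>G\<close> is an open set of space-time on which the velocity field \<open>v\<close> is smooth.\<close>

definition trajectory ::
  "(real^3 \<Rightarrow> real \<Rightarrow> real^3) \<Rightarrow> ((real^3) \<times> real) set \<Rightarrow> real \<Rightarrow> real \<Rightarrow> real^3 \<Rightarrow> (real \<Rightarrow> real^3) \<Rightarrow> bool" where
  "trajectory v G t0 T x0 x \<longleftrightarrow> x t0 = x0 \<and>
     (\<forall>t\<in>{t0..t0+T}. (x t, t) \<in> G \<and>
        (x has_vector_derivative v (x t) t) (at t within {t0..t0+T}))"

definition flow_map ::
  "(real^3 \<Rightarrow> real \<Rightarrow> real^3) \<Rightarrow> ((real^3) \<times> real) set \<Rightarrow> real \<Rightarrow> real \<Rightarrow> real \<Rightarrow> real^3 \<Rightarrow> real^3" where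
  "flow_map v G t0 T t x0 = (THE y. \<exists>x. trajectory v G t0 T x0 x \<and> y = x t)"

definition flow_gradient ::
  "(real^3 \<Rightarrow> real \<Rightarrow> real^3) \<Rightarrow> ((real^3) \<times> real) set \<Rightarrow> real \<Rightarrow> real \<Rightarrow> real^3 \<Rightarrow> real^3^3" where
  "flow_gradient v G t0 T x0 = jacobian (flow_map v G t0 T (t0+T)) (at x0)"

definition cauchy_green ::
  "(real^3 \<Rightarrow> real \<Rightarrow> real^3) \<Rightarrow> ((real^3) \<times> real) set \<Rightarrow> real \<Rightarrow> real \<Rightarrow> real^3 \<Rightarrow> real^3^3" where
  "cauchy_green v G t0 T x0 =
     transpose (flow_gradient v G t0 T x0) ** flow_gradient v G t0 T x0"

text \<open>The eigenvalues are listed in increasing order, with multiplicity; the index runs over 1, 2, 3.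
  The eigenvectors are determined only up to orientation (and up to rotation in a multiple eigenspace).\<close>

definition ordered_eigensystem :: "real^3^3 \<Rightarrow> (nat \<Rightarrow> real) \<Rightarrow> (nat \<Rightarrow> real^3) \<Rightarrow> bool" where
  "ordered_eigensystem C l e \<longleftrightarrow>
     (\<forall>i\<in>{1,2,3}. C *v e i = l i *\<^sub>R e i) \<and>
     (\<forall>i\<in>{1,2,3}. \<forall>j\<in>{1,2,3}. e i \<bullet> e j = (if i = j then 1 else 0)) \<and>
     l 1 \<le> l 2 \<and> l 2 \<le> l 3"

text \<open>\<open>W\<close> is a set of initial positions whose trajectories exist on the whole time interval.\<close>

definition material_surface ::
  "(real^3 \<Rightarrow> real \<Rightarrow> real^3) \<Rightarrow> ((real^3) \<times> real) set \<Rightarrow> (real^3) set \<Rightarrow> real \<Rightarrow> real \<Rightarrow>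
   (real \<Rightarrow> (real^3) set) \<Rightarrow> bool" where
  "material_surface v G W t0 T M \<longleftrightarrow>
     smooth_surface (M t0) \<and> M t0 \<subseteq> W \<and> (\<forall>t\<in>{t0..t0+T}. M t = flow_map v G t0 T t ` M t0)"

section \<open>Normal repulsion, tangential shear and Lagrangian coherent structures\<close>

text \<open>In the next three definitions \<open>A\<close> is the flow gradient at \<open>x\<^sub>0\<close>.\<close>

definition advected_normal :: "real^3^3 \<Rightarrow> real^3 \<Rightarrow> real^3" where
  "advected_normal A n =
     (transpose (matrix_inv A) *v n) /\<^sub>R norm (transpose (matrix_inv A) *v n)"

definition normal_repulsion :: "real^3^3 \<Rightarrow> real^3 \<Rightarrow> real" where
  "normal_repulsion A n = advected_normal A n \<bullet> (A *v n)"

definition tangential_shear :: "real^3^3 \<Rightarrow> real^3 \<Rightarrow> real" where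
  "tangential_shear A n =
     norm (A *v n - (advected_normal A n \<bullet> (A *v n)) *\<^sub>R advected_normal A n)"

text \<open>\<open>compared_with_others v G W t0 T M P\<close>: the relation \<open>P x\<^sub>0 n\<^sub>0 m\<^sub>0\<close> holds for every point \<open>x\<^sub>0\<close>
  and unit normal \<open>n\<^sub>0\<close> of the initial surface and every unit normal \<open>m\<^sub>0\<close>, not parallel to \<open>n\<^sub>0\<close>,
  at \<open>x\<^sub>0\<close> of another material surface through \<open>x\<^sub>0\<close>.\<close>

definition compared_with_others ::
  "(real^3 \<Rightarrow> real \<Rightarrow> real^3) \<Rightarrow> ((real^3) \<times> real) set \<Rightarrow> (real^3) set \<Rightarrow> real \<Rightarrow> real \<Rightarrow>
   (real \<Rightarrow> (real^3) set) \<Rightarrow> (real^3 \<Rightarrow> real^3 \<Rightarrow> real^3 \<Rightarrow> bool) \<Rightarrow> bool" where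
  "compared_with_others v G W t0 T M P \<longleftrightarrow>
     (\<forall>x0\<in>M t0. \<forall>n0 N m0.
        unit_normal (M t0) x0 n0 \<and>
        material_surface v G W t0 T N \<and> x0 \<in> N t0 \<and> unit_normal (N t0) x0 m0 \<and>
        \<not> collinear {0, n0, m0} \<longrightarrow> P x0 n0 m0)"

definition repelling_LCS ::
  "(real^3 \<Rightarrow> real \<Rightarrow> real^3) \<Rightarrow> ((real^3) \<times> real) set \<Rightarrow> (real^3) set \<Rightarrow> real \<Rightarrow> real \<Rightarrow>
   (real \<Rightarrow> (real^3) set) \<Rightarrow> bool" where
  "repelling_LCS v G W t0 T M \<longleftrightarrow> material_surface v G W t0 T M \<and>
     compared_with_others v G W t0 T M (\<lambda>x0 n0 m0.
       normal_repulsion (flow_gradient v G t0 T x0) m0 < normal_repulsion (flow_gradient v G t0 T x0) n0 \<and>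
       normal_repulsion (flow_gradient v G t0 T x0) n0 > 1)"

definition attracting_LCS ::
  "(real^3 \<Rightarrow> real \<Rightarrow> real^3) \<Rightarrow> ((real^3) \<times> real) set \<Rightarrow> (real^3) set \<Rightarrow> real \<Rightarrow> real \<Rightarrow>
   (real \<Rightarrow> (real^3) set) \<Rightarrow> bool" where
  "attracting_LCS v G W t0 T M \<longleftrightarrow> material_surface v G W t0 T M \<and>
     compared_with_others v G W t0 T M (\<lambda>x0 n0 m0.
       normal_repulsion (flow_gradient v G t0 T x0) m0 > normal_repulsion (flow_gradient v G t0 T x0) n0 \<and>
       normal_repulsion (flow_gradient v G t0 T x0) n0 < 1)"

definition shear_LCS ::
  "(real^3 \<Rightarrow> real \<Rightarrow> real^3) \<Rightarrow> ((real^3) \<times> real) set \<Rightarrow> (real^3) set \<Rightarrow> real \<Rightarrow> real \<Rightarrow>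
   (real \<Rightarrow> (real^3) set) \<Rightarrow> bool" where
  "shear_LCS v G W t0 T M \<longleftrightarrow> material_surface v G W t0 T M \<and>
     compared_with_others v G W t0 T M (\<lambda>x0 n0 m0.
       tangential_shear (flow_gradient v G t0 T x0) m0 \<le> tangential_shear (flow_gradient v G t0 T x0) n0)"

definition distinct_strain_set :: "(real^3) set \<Rightarrow> (real^3 \<Rightarrow> nat \<Rightarrow> real) \<Rightarrow> (real^3) set" where
  "distinct_strain_set D l = {x\<in>D. 0 < l x 1 \<and> l x 1 < l x 2 \<and> l x 2 < l x 3}"

text \<open>The sign \<open>s\<close> is 1 or -1.\<close>

definition shear_normal :: "real \<Rightarrow> (nat \<Rightarrow> real) \<Rightarrow> (nat \<Rightarrow> real^3) \<Rightarrow> real^3" where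
  "shear_normal s l e =
     sqrt (sqrt (l 1) / (sqrt (l 1) + sqrt (l 3))) *\<^sub>R e 1 +
     s *\<^sub>R (sqrt (sqrt (l 3) / (sqrt (l 1) + sqrt (l 3))) *\<^sub>R e 3)"

end

theory Submission
  imports Defs
begin

text \<open>Let \<open>A\<close> be the flow gradient at a point and \<open>q(n) = \<Sum>\<^sub>i (n \<bullet> \<xi>\<^sub>i)\<^sup>2 / \<lambda>\<^sub>i\<close>.
  Since \<open>A\<^sup>-\<^sup>*n \<bullet> A n = 1\<close> and \<open>|A\<^sup>-\<^sup>*n|\<^sup>2 = q(n)\<close> for a unit vector \<open>n\<close>, the repulsion is
  \<open>\<rho> = 1 / \<surd>q\<close>, extremal exactly at \<open>\<plusminus>\<xi>\<^sub>3\<close> and \<open>\<plusminus>\<xi>\<^sub>1\<close>, while the shear satisfies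
  \<open>\<sigma>\<^sup>2 = \<Sum>\<^sub>i \<lambda>\<^sub>i (n \<bullet> \<xi>\<^sub>i)\<^sup>2 - 1 / q \<le> (\<surd>\<lambda>\<^sub>3 - \<surd>\<lambda>\<^sub>1)\<^sup>2\<close> with equality exactly at \<open>\<plusminus>n\<^sub>\<plusminus>\<close>.
  A small disk orthogonal to any prescribed unit vector is a competing material surface, so these
  pointwise extremum problems are equivalent to the coherence conditions.\<close>

section \<open>Calculus of smooth maps\<close>

lemma smooth_on_imp_open: "smooth_on S f \<Longrightarrow> open S"
  by (simp add: smooth_on_def)

lemma smooth_on_imp_has_derivative:
  assumes "smooth_on S f" "x \<in> S"
  shows "(f has_derivative frechet_derivative f (at x)) (at x)"
proof -
  have "Ck_on (Suc 0) f S" "open S"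
    using assms(1) unfolding smooth_on_def by blast+
  then have "f differentiable (at x)"
    using assms(2) by (simp add: differentiable_on_eq_differentiable_at)
  then show ?thesis
    by (simp add: frechet_derivative_works)
qed

lemma smooth_on_imp_continuous_frechet_derivative:
  assumes "smooth_on S f" "b \<in> Basis"
  shows "continuous_on S (\<lambda>x. frechet_derivative f (at x) b)"
proof -
  have "Ck_on (Suc 0) f S"
    using assms(1) unfolding smooth_on_def by blast
  then show ?thesis
    using assms(2) by simp
qed

lemma Ck_on_const: "Ck_on k (\<lambda>x. c) S"
  by (induction k arbitrary: c) (auto simp: frechet_derivative_const)

text \<open>The first derivative is constant, so \<open>Ck_on_const\<close> settles all higher
  orders. The form \<open>f (x - a) + c\<close> fits both the chart of a disk and the inverse of
  that chart.\<close>

lemma smooth_on_affine: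
  fixes f :: "'a::euclidean_space \<Rightarrow> 'b::real_normed_vector"
  assumes f: "linear f" and S: "open S"
  shows "smooth_on S (\<lambda>x. f (x - a) + c)"
proof -
  have der: "((\<lambda>x. f (x - a) + c) has_derivative f) (at x)" for x
  proof -
    have "bounded_linear f"
      using f by (simp add: linear_conv_bounded_linear)
    then show ?thesis
      by (auto intro!: derivative_eq_intros bounded_linear.has_derivative[of f])
  qed
  then have diff: "(\<lambda>x. f (x - a) + c) differentiable_on S"
    by (meson differentiableI differentiable_at_imp_differentiable_on)
  have "Ck_on k (\<lambda>x. f (x - a) + c) S" for k
  proof (cases k)
    case 0
    then show ?thesis
      using diff differentiable_imp_continuous_on by auto
  next
    case (Suc k')
    have "frechet_derivative (\<lambda>x. f (x - a) + c) (at x) = f" for x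
      using frechet_derivative_at[OF der] by simp
    then show ?thesis
      using Suc diff by (simp add: Ck_on_const)
  qed
  then show ?thesis
    using S by (simp add: smooth_on_def)
qed

section \<open>Normals of a smooth surface\<close>

text \<open>Near \<open>p\<close> the surface is the zero set of the third chart component, and
  \<nu> is the gradient of that component. Differentiating along curves in the surface, and
  conversely lifting segments of the slice plane, shows that the tangent space is the full
  orthogonal complement of \<nu>; hence the normals form a line. Continuity of \<nu> serves the
  comparison of signs at neighbouring points later on.\<close>

lemma smooth_surface_local_normal:
  assumes "smooth_surface S" "p \<in> S"
  obtains A \<nu> where "open A" "p \<in> A" "continuous_on A \<nu>"
    and "\<And>x. x \<in> S \<inter> A \<Longrightarrow> \<nu> x \<noteq> 0"
    and "\<And>x m. x \<in> S \<inter> A \<Longrightarrow> perp_tangent S x m \<longleftrightarrow> (\<exists>c. m = c *\<^sub>R \<nu> x)"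
proof -
  obtain A B and \<phi> \<psi> :: "real^3 \<Rightarrow> real^3" where pA: "p \<in> A" and hom: "homeomorphism A B \<phi> \<psi>"
    and s\<phi>: "smooth_on A \<phi>" and s\<psi>: "smooth_on B \<psi>"
    and slice: "\<phi> ` (S \<inter> A) = {y\<in>B. y $ 3 = 0}"
    using assms unfolding smooth_surface_def by blast
  have oA: "open A" and oB: "open B"
    using s\<phi> s\<psi> by (auto intro: smooth_on_imp_open)
  let ?D = "\<lambda>x. frechet_derivative \<phi> (at x)"
  let ?E = "\<lambda>y. frechet_derivative \<psi> (at y)"
  \<comment> \<open>The gradient of the third component of \<phi>, written through its partial
    derivatives so that continuity is immediate.\<close>
  define \<nu> where "\<nu> x = (\<Sum>b\<in>Basis. (?D x b $ 3) *\<^sub>R b)" for x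
  have cont: "continuous_on A \<nu>"
    unfolding \<nu>_def
    by (intro continuous_intros smooth_on_imp_continuous_frechet_derivative[OF s\<phi>])
  have dD: "(\<phi> has_derivative ?D x) (at x)" if "x \<in> A" for x
    using smooth_on_imp_has_derivative[OF s\<phi> that] .
  have dE: "(\<psi> has_derivative ?E y) (at y)" if "y \<in> B" for y
    using smooth_on_imp_has_derivative[OF s\<psi> that] .
  have \<nu>: "\<nu> x \<bullet> w = ?D x w $ 3" if "x \<in> A" for x w
  proof -
    have lin: "linear (?D x)"
      using dD[OF that] has_derivative_linear by blast
    have "?D x w = ?D x (\<Sum>b\<in>Basis. (w \<bullet> b) *\<^sub>R b)"
      by (simp add: euclidean_representation)
    also have "\<dots> = (\<Sum>b\<in>Basis. (w \<bullet> b) *\<^sub>R ?D x b)"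
      by (simp add: linear_sum[OF lin] linear_cmul[OF lin])
    finally have "?D x w $ 3 = (\<Sum>b\<in>Basis. (?D x b $ 3) * (b \<bullet> w))"
      by (simp add: inner_commute mult.commute)
    then show ?thesis
      by (simp add: \<nu>_def inner_sum_left)
  qed
  have \<phi>B: "\<phi> x \<in> B" and \<psi>\<phi>: "\<psi> (\<phi> x) = x" if "x \<in> A" for x
    using hom that by (auto simp: homeomorphism_def)
  have \<phi>\<psi>: "\<phi> (\<psi> y) = y" if "y \<in> B" for y
    using hom that by (auto simp: homeomorphism_def)
  \<comment> \<open>The chain rule for the two compositions of \<phi> and \<psi> makes the chart
    derivative invertible.\<close>
  have ED: "?E (\<phi> x) (?D x w) = w" if x: "x \<in> A" for x w
  proof -
    have "(\<psi> \<circ> \<phi> has_derivative ?E (\<phi> x) \<circ> ?D x) (at x)"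
      using diff_chain_at[OF dD[OF x] dE[OF \<phi>B[OF x]]] .
    then have "((\<lambda>x. x) has_derivative ?E (\<phi> x) \<circ> ?D x) (at x)"
      by (rule has_derivative_transform_within_open[OF _ oA x]) (simp add: \<psi>\<phi>)
    then have "?E (\<phi> x) \<circ> ?D x = (\<lambda>x. x)"
      using has_derivative_unique has_derivative_ident by blast
    then show ?thesis
      by (metis comp_apply)
  qed
  have DE: "?D x (?E (\<phi> x) w) = w" if x: "x \<in> A" for x w
  proof -
    have "(\<phi> \<circ> \<psi> has_derivative ?D x \<circ> ?E (\<phi> x)) (at (\<phi> x))"
      using diff_chain_at[OF dE[OF \<phi>B[OF x]]] dD[OF x] \<psi>\<phi>[OF x] by simp
    then have "((\<lambda>x. x) has_derivative ?D x \<circ> ?E (\<phi> x)) (at (\<phi> x))"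
      by (rule has_derivative_transform_within_open[OF _ oB \<phi>B[OF x]]) (simp add: \<phi>\<psi>)
    then have "?D x \<circ> ?E (\<phi> x) = (\<lambda>x. x)"
      using has_derivative_unique has_derivative_ident by blast
    then show ?thesis
      by (metis comp_apply)
  qed
  have tangent: "w \<in> tangent_space S x \<longleftrightarrow> \<nu> x \<bullet> w = 0" if x: "x \<in> S \<inter> A" for x w
  proof
    assume "w \<in> tangent_space S x"
    then obtain c \<epsilon> where e: "0 < \<epsilon>" and c0: "c 0 = x" and cS: "\<And>s. s \<in> {-\<epsilon><..<\<epsilon>} \<Longrightarrow> c s \<in> S"
      and cw: "(c has_vector_derivative w) (at (0::real))"
      unfolding tangent_space_def by blast
    have cw': "(c has_derivative (\<lambda>s. s *\<^sub>R w)) (at 0)"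
      using cw by (simp add: has_vector_derivative_def)
    have "(\<phi> \<circ> c has_derivative ?D x \<circ> (\<lambda>s. s *\<^sub>R w)) (at 0)"
      using diff_chain_at[OF cw'] dD[of x] x c0 by simp
    then have d1: "((\<lambda>s. (\<phi> \<circ> c) s $ 3) has_derivative (\<lambda>s. (?D x \<circ> (\<lambda>s. s *\<^sub>R w)) s $ 3)) (at 0)"
      using bounded_linear.has_derivative[OF bounded_linear_vec_nth] by blast
    have "isCont c 0"
      using cw' has_derivative_continuous by blast
    then have "\<forall>\<^sub>F s in at 0. c s \<in> A"
      using oA x c0 by (metis IntD2 isCont_def topological_tendstoD)
    moreover have "\<forall>\<^sub>F s in at (0::real). s \<in> {-\<epsilon><..<\<epsilon>}"
      using e by (intro eventually_at_in_open') auto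
    ultimately have "\<forall>\<^sub>F s in at 0. (\<phi> \<circ> c) s $ 3 = 0"
    proof eventually_elim
      case (elim s)
      then have "\<phi> (c s) \<in> \<phi> ` (S \<inter> A)"
        using cS by blast
      then show ?case
        unfolding slice by simp
    qed
    moreover have "\<phi> x $ 3 = 0"
      using x slice by blast
    ultimately have "((\<lambda>s. 0) has_derivative (\<lambda>s. (?D x \<circ> (\<lambda>s. s *\<^sub>R w)) s $ 3)) (at (0::real))"
      using has_derivative_transform_eventually[OF d1, of "\<lambda>s. 0"] c0 by simp
    then have "(\<lambda>s. (?D x \<circ> (\<lambda>s. s *\<^sub>R w)) s $ 3) = (\<lambda>s. 0)"
      using has_derivative_unique has_derivative_const by blast
    from fun_cong[OF this, of 1] show "\<nu> x \<bullet> w = 0"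
      using \<nu> x by simp
  next
    assume orth: "\<nu> x \<bullet> w = 0"
    define d where "d = ?D x w"
    \<comment> \<open>A straight segment in the slice plane with direction \<open>d\<close>, pulled
      back to the surface; its velocity is \<open>?E (\<phi> x) d = w\<close>.\<close>
    define c where "c s = \<psi> (\<phi> x + s *\<^sub>R d)" for s
    have xA: "x \<in> A"
      using x by simp
    have d3: "d $ 3 = 0"
      using orth \<nu> xA by (simp add: d_def)
    have x3: "\<phi> x $ 3 = 0"
      using x slice by blast
    have "((\<lambda>s. \<phi> x + s *\<^sub>R d) has_derivative (\<lambda>s. s *\<^sub>R d)) (at (0::real))"
      by (auto intro!: derivative_eq_intros)
    from diff_chain_at[OF this, of \<psi> "?E (\<phi> x)"] dE[OF \<phi>B[OF xA]]
    have "(c has_derivative ?E (\<phi> x) \<circ> (\<lambda>s. s *\<^sub>R d)) (at 0)"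
      by (simp add: c_def[abs_def] comp_def)
    moreover have "?E (\<phi> x) (s *\<^sub>R d) = s *\<^sub>R w" for s
      using has_derivative_linear[OF dE[OF \<phi>B[OF xA]]] ED[OF xA] by (simp add: linear_cmul d_def)
    ultimately have der: "(c has_vector_derivative w) (at 0)"
      by (simp add: has_vector_derivative_def comp_def)
    have "open ((\<lambda>s. \<phi> x + s *\<^sub>R d) -` B)"
      by (rule open_vimage[OF oB]) (intro continuous_intros)
    moreover have "0 \<in> (\<lambda>s. \<phi> x + s *\<^sub>R d) -` B"
      using \<phi>B[OF xA] by simp
    ultimately obtain \<epsilon> where e: "0 < \<epsilon>" "ball 0 \<epsilon> \<subseteq> (\<lambda>s. \<phi> x + s *\<^sub>R d) -` B"
      using open_contains_ball by blast
    have "c s \<in> S" if "s \<in> {-\<epsilon><..<\<epsilon>}" for s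
    proof -
      have "s \<in> ball 0 \<epsilon>"
        using that by (auto simp: dist_norm)
      then have "\<phi> x + s *\<^sub>R d \<in> {y\<in>B. y $ 3 = 0}"
        using e(2) d3 x3 by auto
      then show ?thesis
        unfolding slice[symmetric] c_def using \<psi>\<phi> by auto
    qed
    moreover have "c 0 = x"
      using \<psi>\<phi>[OF xA] by (simp add: c_def)
    ultimately show "w \<in> tangent_space S x"
      unfolding tangent_space_def using e(1) der by blast
  qed
  show ?thesis
  proof (rule that[OF oA pA cont])
    fix x assume x: "x \<in> S \<inter> A"
    \<comment> \<open>The preimage of the third axis under the chart derivative witnesses that the
      gradient does not vanish.\<close>
    have "\<nu> x \<bullet> ?E (\<phi> x) (axis 3 1) = 1"
      using \<nu> DE x by simp
    then show nz: "\<nu> x \<noteq> 0"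
      by auto
    fix m
    show "perp_tangent S x m \<longleftrightarrow> (\<exists>c. m = c *\<^sub>R \<nu> x)"
    proof
      assume perp: "perp_tangent S x m"
      \<comment> \<open>\<open>w\<close> is the part of \<open>m\<close> orthogonal to \<nu>. It is
        tangent, hence orthogonal to \<open>m\<close> as well, hence to itself.\<close>
      define k where "k = (\<nu> x \<bullet> m) / (\<nu> x \<bullet> \<nu> x)"
      define w where "w = m - k *\<^sub>R \<nu> x"
      have \<nu>w: "\<nu> x \<bullet> w = 0"
        using nz by (simp add: w_def k_def inner_diff_right)
      then have "m \<bullet> w = 0"
        using tangent[OF x] perp by (auto simp: perp_tangent_def orthogonal_def)
      then have "w \<bullet> w = 0"
        using \<nu>w by (simp add: w_def inner_diff_left)
      then show "\<exists>c. m = c *\<^sub>R \<nu> x"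
        by (auto simp: w_def)
    next
      assume "\<exists>c. m = c *\<^sub>R \<nu> x"
      then show "perp_tangent S x m"
        using tangent[OF x] by (auto simp: perp_tangent_def orthogonal_def)
    qed
  qed
qed

lemma collinear_unit_iff:
  assumes "norm n = 1" "norm m = 1"
  shows "collinear {0, n, m} \<longleftrightarrow> m = n \<or> m = - n"
proof
  assume "collinear {0, n, m}"
  moreover have "n \<noteq> 0" "m \<noteq> 0"
    using assms by auto
  ultimately obtain c where c: "m = c *\<^sub>R n"
    using collinear_lemma by blast
  then have "\<bar>c\<bar> = 1"
    using assms by simp
  then show "m = n \<or> m = - n"
    using c by (cases "c \<ge> 0") auto
next
  assume "m = n \<or> m = - n"
  then show "collinear {0, n, m}"
    by (metis collinear_lemma scaleR_minus1_left scaleR_one)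
qed

lemma smooth_surface_unit_normal:
  assumes "smooth_surface S" "p \<in> S"
  obtains n where "unit_normal S p n" "\<And>m. perp_tangent S p m \<longleftrightarrow> (\<exists>c. m = c *\<^sub>R n)"
proof -
  obtain A \<nu> where "p \<in> A" and nz: "\<nu> p \<noteq> 0"
    and perp: "\<And>m. perp_tangent S p m \<longleftrightarrow> (\<exists>c. m = c *\<^sub>R \<nu> p)"
    using smooth_surface_local_normal[OF assms] assms(2) by (metis IntI)
  define n where "n = \<nu> p /\<^sub>R norm (\<nu> p)"
  have "\<nu> p = norm (\<nu> p) *\<^sub>R n"
    using nz by (simp add: n_def)
  then have "(\<exists>c. m = c *\<^sub>R \<nu> p) \<longleftrightarrow> (\<exists>c. m = c *\<^sub>R n)" for m
    unfolding n_def by (metis scaleR_scaleR)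
  with perp have perp': "perp_tangent S p m \<longleftrightarrow> (\<exists>c. m = c *\<^sub>R n)" for m
    by blast
  moreover have "norm n = 1"
    using nz by (simp add: n_def)
  ultimately show ?thesis
    using that[of n] by (metis scaleR_one unit_normal_def)
qed

text \<open>Exchanges the orthogonality conditions of the theorem for equality up to sign with a
  given unit normal, the form in which the pointwise extremum problems are solved.\<close>

lemma unit_normal_iff_perp_tangent:
  assumes "smooth_surface S" "p \<in> S" "unit_normal S p n" "norm m = 1"
  shows "perp_tangent S p m \<longleftrightarrow> m = n \<or> m = - n"
proof -
  obtain k where k: "norm k = 1" "\<And>m. perp_tangent S p m \<longleftrightarrow> (\<exists>c. m = c *\<^sub>R k)"
    using smooth_surface_unit_normal[OF assms(1,2)] unfolding unit_normal_def by metis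
  have unit: "perp_tangent S p m \<longleftrightarrow> m = k \<or> m = - k" if "norm m = 1" for m
  proof -
    have "k \<noteq> 0" "m \<noteq> 0"
      using k(1) that by auto
    then have "perp_tangent S p m \<longleftrightarrow> collinear {0, k, m}"
      using k(2) by (simp add: collinear_lemma)
    then show ?thesis
      using collinear_unit_iff[OF k(1) that] by simp
  qed
  have "n = k \<or> n = - k"
    using assms(3) unit by (auto simp: unit_normal_def)
  then show ?thesis
    using unit[OF assms(4)] by auto
qed

section \<open>Disks as competing material surfaces\<close>

text \<open>A single slice chart suffices: the rigid motion that moves \<open>p\<close> to the
  origin and \<open>m\<close> to the third axis maps the ball to a ball and the disk to its
  equatorial slice.\<close>

lemma smooth_surface_disk:
  fixes p m :: "real^3"
  assumes m: "norm m = 1"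
  shows "smooth_surface {x \<in> ball p r. m \<bullet> (x - p) = 0}" (is "smooth_surface ?S")
proof -
  obtain f :: "real^3 \<Rightarrow> real^3" where f: "orthogonal_transformation f" "f m = axis 3 1"
    using orthogonal_transformation_exists_1[of m "axis 3 (1::real)"] m
    by (metis norm_axis_1)
  define g where "g = inv f"
  have bf: "bij f"
    using f(1) by (rule orthogonal_transformation_bij)
  have g: "orthogonal_transformation g"
    unfolding g_def using f(1) by (rule orthogonal_transformation_inv)
  have fg: "f (g y) = y" "g (f y) = y" for y
    using bf by (simp_all add: g_def bij_is_surj surj_f_inv_f bij_is_inj)
  have lin: "linear f" "linear g"
    using f g by (simp_all add: orthogonal_transformation_def)
  have nf: "norm (f x) = norm x" "norm (g x) = norm x" for x
    using f g by (simp_all add: orthogonal_transformation_norm)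
  have f3: "f x $ 3 = m \<bullet> x" for x
  proof -
    have "f x $ 3 = f m \<bullet> f x"
      by (simp add: f(2) inner_axis')
    then show ?thesis
      using f(1) by (simp add: orthogonal_transformation_def)
  qed
  let ?\<phi> = "\<lambda>x. f (x - p) + 0" and ?\<psi> = "\<lambda>y. g (y - 0) + p"
  have s: "smooth_on (ball p r) ?\<phi>" "smooth_on (ball 0 r) ?\<psi>"
    by (intro smooth_on_affine lin open_ball)+
  have mem: "?\<phi> x \<in> ball 0 r" if "x \<in> ball p r" for x
    using that by (simp add: nf dist_norm norm_minus_commute)
  have mem': "?\<psi> x \<in> ball p r" if "x \<in> ball 0 r" for x
    using that by (simp add: nf dist_norm)
  have "continuous_on (ball p r) ?\<phi>" "continuous_on (ball 0 r) ?\<psi>"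
    using s by (meson Ck_on.simps(1) smooth_on_def)+
  then have hom: "homeomorphism (ball p r) (ball 0 r) ?\<phi> ?\<psi>"
    by (rule homeomorphismI) (use mem mem' fg in auto)
  have "?\<phi> ` ?S = {y \<in> ball 0 r. y $ 3 = 0}"
  proof (intro equalityI subsetI)
    fix y assume "y \<in> ?\<phi> ` ?S"
    then show "y \<in> {y \<in> ball 0 r. y $ 3 = 0}"
      using mem f3 by auto
  next
    fix y :: "real^3" assume y: "y \<in> {y \<in> ball 0 r. y $ 3 = 0}"
    then have "?\<psi> y \<in> ?S" "y = ?\<phi> (?\<psi> y)"
      using mem' f3[of "g y"] by (auto simp: fg)
    then show "y \<in> ?\<phi> ` ?S"
      by blast
  qed
  moreover have "?S \<inter> ball p r = ?S"
    by blast
  ultimately have slice: "?\<phi> ` (?S \<inter> ball p r) = {y \<in> ball 0 r. y $ 3 = 0}"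
    by simp
  show ?thesis
    unfolding smooth_surface_def
  proof (intro ballI exI conjI)
    fix x assume "x \<in> ?S"
    then show "x \<in> ball p r"
      by blast
  qed (rule hom s slice)+
qed

text \<open>Along any curve in the disk the function \<open>m \<bullet> (c s - p)\<close> vanishes
  identically, so its derivative at 0 does too.\<close>

lemma perp_tangent_disk: "perp_tangent {x \<in> ball p r. m \<bullet> (x - p) = 0} p m"
  unfolding perp_tangent_def orthogonal_def
proof
  fix w assume "w \<in> tangent_space {x \<in> ball p r. m \<bullet> (x - p) = 0} p"
  then obtain c \<epsilon> where e: "0 < \<epsilon>" and cS: "\<And>s. s \<in> {-\<epsilon><..<\<epsilon>} \<Longrightarrow> m \<bullet> (c s - p) = 0"
    and cw: "(c has_vector_derivative w) (at (0::real))"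
    unfolding tangent_space_def by blast
  have "((\<lambda>s. m \<bullet> (c s - p)) has_derivative (\<lambda>s. m \<bullet> (s *\<^sub>R w))) (at 0)"
    using cw unfolding has_vector_derivative_def by (auto intro!: derivative_eq_intros)
  then have "((\<lambda>s. 0) has_derivative (\<lambda>s. m \<bullet> (s *\<^sub>R w))) (at (0::real))"
    by (rule has_derivative_transform_within_open[of _ _ _ _ "{-\<epsilon><..<\<epsilon>}"]) (use e cS in auto)
  then have "(\<lambda>s. m \<bullet> (s *\<^sub>R w)) = (\<lambda>s. 0)"
    using has_derivative_unique has_derivative_const by blast
  from fun_cong[OF this, of 1] show "m \<bullet> w = 0"
    by simp
qed

text \<open>All trajectories from \<open>x0\<close> agree at time \<open>t0\<close>, so the definite
  description in \<open>flow_map\<close> denotes \<open>x0\<close> as soon as one trajectory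
  exists.\<close>

lemma flow_map_initial:
  assumes "trajectory v G t0 T x0 x"
  shows "flow_map v G t0 T t0 x0 = x0"
  unfolding flow_map_def
  by (rule the_equality) (use assms in \<open>auto simp: trajectory_def\<close>)

text \<open>Replaces the quantifier over material surfaces by one over unit vectors: for each unit
  \<open>m0\<close> a disk orthogonal to \<open>m0\<close>, small enough to stay inside the open set
  \<open>W\<close>, is carried along by the flow and has \<open>m0\<close> as a unit normal.\<close>

lemma compared_with_others_iff:
  assumes W: "open W" "\<And>x0. x0 \<in> W \<Longrightarrow> \<exists>x. trajectory v G t0 T x0 x"
    and M: "material_surface v G W t0 T M"
  shows "compared_with_others v G W t0 T M P \<longleftrightarrow>
     (\<forall>x0\<in>M t0. \<forall>n0. unit_normal (M t0) x0 n0 \<longrightarrow>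
       (\<forall>m0. norm m0 = 1 \<and> m0 \<noteq> n0 \<and> m0 \<noteq> - n0 \<longrightarrow> P x0 n0 m0))" (is "_ \<longleftrightarrow> ?R")
proof
  assume L: "compared_with_others v G W t0 T M P"
  show ?R
  proof (intro ballI allI impI)
    fix x0 n0 m0
    assume x0: "x0 \<in> M t0" and n0: "unit_normal (M t0) x0 n0"
      and m0: "norm m0 = 1 \<and> m0 \<noteq> n0 \<and> m0 \<noteq> - n0"
    have "x0 \<in> W"
      using x0 M by (auto simp: material_surface_def)
    then obtain r where r: "0 < r" "ball x0 r \<subseteq> W"
      using W(1) open_contains_ball by blast
    define S where "S = {x \<in> ball x0 r. m0 \<bullet> (x - x0) = 0}"
    define N where "N t = flow_map v G t0 T t ` S" for t
    have SW: "S \<subseteq> W"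
      using r(2) by (auto simp: S_def)
    have Nt0: "N t0 = S"
      using SW W(2) flow_map_initial unfolding N_def by (force simp: image_iff)
    have "material_surface v G W t0 T N"
      unfolding material_surface_def Nt0 using SW m0 smooth_surface_disk
      by (auto simp: N_def S_def)
    moreover have "x0 \<in> N t0"
      using r(1) by (simp add: Nt0 S_def)
    moreover have "unit_normal (N t0) x0 m0"
      using m0 perp_tangent_disk unfolding Nt0 S_def unit_normal_def by blast
    moreover have "\<not> collinear {0, n0, m0}"
      using n0 m0 collinear_unit_iff by (auto simp: unit_normal_def)
    ultimately show "P x0 n0 m0"
      using L x0 n0 unfolding compared_with_others_def by blast
  qed
next
  assume ?R
  then show "compared_with_others v G W t0 T M P"
    unfolding compared_with_others_def by (metis collinear_unit_iff unit_normal_def)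
qed

section \<open>Linear algebra of the strain tensor at a fixed point\<close>

locale strain =
  fixes A :: "real^3^3" and l :: "nat \<Rightarrow> real" and e :: "nat \<Rightarrow> real^3"
  assumes eigensystem: "ordered_eigensystem (transpose A ** A) l e"
    and l: "0 < l 1" "l 1 < l 2" "l 2 < l 3"
begin

text \<open>Keeps the index in \<open>e 1\<close> and \<open>l 1\<close> from being rewritten to
  \<open>Suc 0\<close>, so that the facts below still match as simp rules.\<close>

declare One_nat_def [simp del]

lemma eigenvector: "i \<in> {1,2,3} \<Longrightarrow> (transpose A ** A) *v e i = l i *\<^sub>R e i"
  using eigensystem unfolding ordered_eigensystem_def by blast

lemma orthonormal: "i \<in> {1,2,3} \<Longrightarrow> j \<in> {1,2,3} \<Longrightarrow> e i \<bullet> e j = (if i = j then 1 else 0)"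
  using eigensystem unfolding ordered_eigensystem_def by blast

lemma inner_e [simp]:
  "e 1 \<bullet> e 1 = 1" "e 1 \<bullet> e 2 = 0" "e 1 \<bullet> e 3 = 0"
  "e 2 \<bullet> e 1 = 0" "e 2 \<bullet> e 2 = 1" "e 2 \<bullet> e 3 = 0"
  "e 3 \<bullet> e 1 = 0" "e 3 \<bullet> e 2 = 0" "e 3 \<bullet> e 3 = 1"
  using orthonormal[of 1 1] orthonormal[of 1 2] orthonormal[of 1 3]
    orthonormal[of 2 1] orthonormal[of 2 2] orthonormal[of 2 3]
    orthonormal[of 3 1] orthonormal[of 3 2] orthonormal[of 3 3] by simp_all

lemma norm_e: "norm (e 1) = 1" "norm (e 2) = 1" "norm (e 3) = 1"
  by (simp_all add: norm_eq_1)

text \<open>Three orthonormal vectors are independent, so in dimension three they span the whole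
  space.\<close>

lemma expand: "x = (x \<bullet> e 1) *\<^sub>R e 1 + (x \<bullet> e 2) *\<^sub>R e 2 + (x \<bullet> e 3) *\<^sub>R e 3"
proof -
  have ne: "e 1 \<noteq> e 2" "e 1 \<noteq> e 3" "e 2 \<noteq> e 3"
    using inner_e by (metis zero_neq_one)+
  let ?B = "{e 1, e 2, e 3}"
  have orth: "pairwise orthogonal ?B"
    by (auto simp: pairwise_def orthogonal_def)
  moreover have "0 \<notin> ?B"
    using norm_e by force
  ultimately have "independent ?B"
    by (rule pairwise_orthogonal_independent)
  moreover have "card ?B = 3"
    using ne by simp
  ultimately have "x \<in> span ?B"
    using card_ge_dim_independent[of ?B UNIV] by auto
  then have "(\<Sum>v\<in>?B. (x \<bullet> v) *\<^sub>R v) = x"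
    using norm_e by (intro orthonormal_basis_expand[OF orth]) auto
  then show ?thesis
    using ne by (simp add: add.assoc)
qed

lemma inner_expand:
  "x \<bullet> y = (x \<bullet> e 1) * (y \<bullet> e 1) + (x \<bullet> e 2) * (y \<bullet> e 2) + (x \<bullet> e 3) * (y \<bullet> e 3)"
proof -
  have "x \<bullet> y = ((x \<bullet> e 1) *\<^sub>R e 1 + (x \<bullet> e 2) *\<^sub>R e 2 + (x \<bullet> e 3) *\<^sub>R e 3) \<bullet> y"
    using expand[of x] by simp
  also have "\<dots> = (x \<bullet> e 1) * (y \<bullet> e 1) + (x \<bullet> e 2) * (y \<bullet> e 2) + (x \<bullet> e 3) * (y \<bullet> e 3)"
    by (simp add: inner_add_left inner_commute[of "e _" y])
  finally show ?thesis .
qed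

lemma unit_expand: "norm n = 1 \<Longrightarrow> (n \<bullet> e 1)\<^sup>2 + (n \<bullet> e 2)\<^sup>2 + (n \<bullet> e 3)\<^sup>2 = 1"
  using inner_expand[of n n] by (simp add: power2_eq_square norm_eq_1)

lemma strain_expand:
  "(transpose A ** A) *v x =
     (l 1 * (x \<bullet> e 1)) *\<^sub>R e 1 + (l 2 * (x \<bullet> e 2)) *\<^sub>R e 2 + (l 3 * (x \<bullet> e 3)) *\<^sub>R e 3"
proof -
  have "(transpose A ** A) *v x =
      (transpose A ** A) *v ((x \<bullet> e 1) *\<^sub>R e 1 + (x \<bullet> e 2) *\<^sub>R e 2 + (x \<bullet> e 3) *\<^sub>R e 3)"
    using expand[of x] by simp
  then show ?thesis
    by (simp add: matrix_vector_right_distrib matrix_vector_mult_scaleR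
        eigenvector[of 1, simplified] eigenvector[of 2, simplified] eigenvector[of 3, simplified]
        mult.commute)
qed

lemma norm_image_sq:
  "(norm (A *v x))\<^sup>2 = l 1 * (x \<bullet> e 1)\<^sup>2 + l 2 * (x \<bullet> e 2)\<^sup>2 + l 3 * (x \<bullet> e 3)\<^sup>2"
proof -
  have "(norm (A *v x))\<^sup>2 = x \<bullet> ((transpose A ** A) *v x)"
    unfolding power2_norm_eq_inner
    by (metis dot_lmul_matrix inner_commute matrix_vector_mul_assoc transpose_matrix_vector)
  then show ?thesis
    by (simp add: strain_expand inner_add_right power2_eq_square algebra_simps)
qed

lemma l_pos: "l 1 > 0" "l 2 > 0" "l 3 > 0"
  using l by simp_all

text \<open>Follows from positivity of the eigenvalues: by \<open>norm_image_sq\<close> a kernel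
  vector has no component along any \<open>e i\<close>.\<close>

lemma invertible: "invertible A"
proof -
  have "x = 0" if "A *v x = 0" for x
  proof -
    have "l 1 * (x \<bullet> e 1)\<^sup>2 + l 2 * (x \<bullet> e 2)\<^sup>2 + l 3 * (x \<bullet> e 3)\<^sup>2 = 0"
      using norm_image_sq[of x] that by simp
    moreover have "l 1 * (x \<bullet> e 1)\<^sup>2 \<ge> 0" "l 2 * (x \<bullet> e 2)\<^sup>2 \<ge> 0" "l 3 * (x \<bullet> e 3)\<^sup>2 \<ge> 0"
      using l_pos by simp_all
    ultimately have "l 1 * (x \<bullet> e 1)\<^sup>2 = 0" "l 2 * (x \<bullet> e 2)\<^sup>2 = 0" "l 3 * (x \<bullet> e 3)\<^sup>2 = 0"
      by linarith+
    then have "x \<bullet> e 1 = 0" "x \<bullet> e 2 = 0" "x \<bullet> e 3 = 0"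
      using l_pos by simp_all
    then show ?thesis
      using expand[of x] by simp
  qed
  then show ?thesis
    by (simp add: invertible_left_inverse matrix_left_invertible_ker)
qed

lemma matrix_inv_mult: "matrix_inv A ** A = mat 1" "A ** matrix_inv A = mat 1"
  using someI_ex[OF invertible[unfolded invertible_def]] by (simp_all add: matrix_inv_def)

text \<open>The quadratic form of the inverse Cauchy-Green tensor, written in the
  eigenbasis.\<close>

definition inv_form :: "real^3 \<Rightarrow> real" where
  "inv_form n = (n \<bullet> e 1)\<^sup>2 / l 1 + (n \<bullet> e 2)\<^sup>2 / l 2 + (n \<bullet> e 3)\<^sup>2 / l 3"

lemma norm_inv_transpose_sq: "(norm (transpose (matrix_inv A) *v n))\<^sup>2 = inv_form n"
proof -
  \<comment> \<open>\<open>u\<close> is the inverse Cauchy-Green tensor applied to \<open>n\<close>.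
    Then the inverse transpose of \<open>A\<close> sends \<open>n\<close> to \<open>A *v u\<close>,
    whose norm \<open>norm_image_sq\<close> computes.\<close>
  define u where "u = ((n \<bullet> e 1) / l 1) *\<^sub>R e 1 + ((n \<bullet> e 2) / l 2) *\<^sub>R e 2 + ((n \<bullet> e 3) / l 3) *\<^sub>R e 3"
  have u: "u \<bullet> e 1 = (n \<bullet> e 1) / l 1" "u \<bullet> e 2 = (n \<bullet> e 2) / l 2" "u \<bullet> e 3 = (n \<bullet> e 3) / l 3"
    by (simp_all add: u_def inner_add_left)
  have "(transpose A ** A) *v u = n"
    unfolding strain_expand u using l_pos expand[of n] by simp
  then have "transpose (matrix_inv A) *v n = (transpose (matrix_inv A) ** transpose A) *v (A *v u)"
    by (metis matrix_mul_assoc matrix_vector_mul_assoc)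
  also have "transpose (matrix_inv A) ** transpose A = mat 1"
    using matrix_inv_mult by (simp flip: matrix_transpose_mul)
  finally have "transpose (matrix_inv A) *v n = A *v u"
    by simp
  then show ?thesis
    using l_pos by (simp add: inv_form_def norm_image_sq u power_divide power2_eq_square[of "l _"])
qed

lemma unit_inner_inv_transpose:
  assumes "norm n = 1"
  shows "(transpose (matrix_inv A) *v n) \<bullet> (A *v n) = 1"
proof -
  have "(transpose (matrix_inv A) *v n) \<bullet> (A *v n) = n \<bullet> (matrix_inv A *v (A *v n))"
    by (metis dot_lmul_matrix transpose_matrix_vector)
  also have "\<dots> = 1"
    using matrix_inv_mult assms by (simp add: matrix_vector_mul_assoc norm_eq_1)
  finally show ?thesis .
qed

lemma inv_form_pos:
  assumes "norm n = 1"
  shows "inv_form n > 0"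
proof -
  have "transpose (matrix_inv A) *v n \<noteq> 0"
    using unit_inner_inv_transpose[OF assms] by force
  then show ?thesis
    using norm_inv_transpose_sq[of n] by (metis zero_less_norm_iff zero_less_power)
qed

lemma normal_repulsion_eq:
  assumes "norm n = 1"
  shows "normal_repulsion A n = 1 / sqrt (inv_form n)"
proof -
  have "norm (transpose (matrix_inv A) *v n) = sqrt (inv_form n)"
    by (metis norm_ge_zero norm_inv_transpose_sq real_sqrt_unique)
  then show ?thesis
    using unit_inner_inv_transpose[OF assms]
    by (simp add: normal_repulsion_def advected_normal_def divide_inverse)
qed

lemma tangential_shear_eq:
  assumes "norm n = 1"
  shows "tangential_shear A n =
    sqrt (l 1 * (n \<bullet> e 1)\<^sup>2 + l 2 * (n \<bullet> e 2)\<^sup>2 + l 3 * (n \<bullet> e 3)\<^sup>2 - 1 / inv_form n)"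
proof -
  let ?a = "advected_normal A n"
  have "transpose (matrix_inv A) *v n \<noteq> 0"
    using unit_inner_inv_transpose[OF assms] by force
  then have aa: "?a \<bullet> ?a = 1"
    unfolding norm_eq_1[symmetric] advected_normal_def by simp
  have aA: "(?a \<bullet> (A *v n))\<^sup>2 = 1 / inv_form n"
    using normal_repulsion_eq[OF assms] inv_form_pos[OF assms]
    by (simp add: normal_repulsion_def power_divide)
  \<comment> \<open>Pythagoras for the unit vector \<open>?a\<close>: the shear is what remains of
    \<open>A *v n\<close> after its component along \<open>?a\<close>, the repulsion, is
    removed.\<close>
  have "(tangential_shear A n)\<^sup>2 = (norm (A *v n))\<^sup>2 - (?a \<bullet> (A *v n))\<^sup>2"
    unfolding tangential_shear_def power2_norm_eq_inner
    using aa by (simp add: inner_diff_left inner_diff_right inner_commute power2_eq_square)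
  moreover have "tangential_shear A n \<ge> 0"
    by (simp add: tangential_shear_def)
  ultimately show ?thesis
    unfolding aA norm_image_sq by (metis real_sqrt_unique)
qed

section \<open>Extrema of the normal repulsion\<close>

lemma normal_repulsion_less_iff:
  "norm n = 1 \<Longrightarrow> norm m = 1 \<Longrightarrow> normal_repulsion A m < normal_repulsion A n \<longleftrightarrow> inv_form n < inv_form m"
  by (simp add: normal_repulsion_eq inv_form_pos divide_less_cancel frac_less2 field_simps)

lemma normal_repulsion_gt_1_iff:
  "norm n = 1 \<Longrightarrow> normal_repulsion A n > 1 \<longleftrightarrow> inv_form n < 1"
  by (simp add: normal_repulsion_eq inv_form_pos)

lemma normal_repulsion_lt_1_iff:
  "norm n = 1 \<Longrightarrow> normal_repulsion A n < 1 \<longleftrightarrow> inv_form n > 1"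
  by (simp add: normal_repulsion_eq inv_form_pos)

lemma inv_form_e: "inv_form (e 1) = 1 / l 1" "inv_form (e 3) = 1 / l 3"
  by (simp_all add: inv_form_def)

lemma inv_form_minus: "inv_form (- n) = inv_form n"
  by (simp add: inv_form_def)

lemma unit_eq_e:
  assumes "norm n = 1"
  shows "n \<bullet> e 2 = 0 \<Longrightarrow> n \<bullet> e 3 = 0 \<Longrightarrow> n = e 1 \<or> n = - e 1"
    and "n \<bullet> e 1 = 0 \<Longrightarrow> n \<bullet> e 2 = 0 \<Longrightarrow> n = e 3 \<or> n = - e 3"
  using unit_expand[OF assms] expand[of n] by (auto simp: power2_eq_1_iff)

text \<open>By \<open>unit_expand\<close>, \<open>inv_form n\<close> is a convex combination of the
  reciprocal eigenvalues with weights \<open>(n \<bullet> e i)^2\<close>. The least reciprocal is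
  \<open>1 / l 3\<close>, and the strict ordering leaves equality only when the whole weight sits on
  \<open>e 3\<close>. The bound \<open>inv_form_lt_max\<close> is the same argument at the other
  end.\<close>

lemma inv_form_gt_min:
  assumes n: "norm n = 1" "n \<noteq> e 3" "n \<noteq> - e 3"
  shows "inv_form n > 1 / l 3"
proof -
  have gap: "1 / l 1 - 1 / l 3 > 0" "1 / l 2 - 1 / l 3 > 0"
    using l by (simp_all add: frac_less2)
  have "inv_form n - 1 / l 3 * ((n \<bullet> e 1)\<^sup>2 + (n \<bullet> e 2)\<^sup>2 + (n \<bullet> e 3)\<^sup>2)
      = (1 / l 1 - 1 / l 3) * (n \<bullet> e 1)\<^sup>2 + (1 / l 2 - 1 / l 3) * (n \<bullet> e 2)\<^sup>2"
    by (simp add: inv_form_def algebra_simps)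
  moreover have "\<dots> > 0"
  proof (cases "n \<bullet> e 1 = 0")
    case True
    then have "n \<bullet> e 2 \<noteq> 0"
      using unit_eq_e(2)[OF n(1)] n(2,3) by blast
    then show ?thesis
      using gap True by simp
  next
    case False
    then show ?thesis
      using gap by (intro add_pos_nonneg) simp_all
  qed
  ultimately show ?thesis
    using unit_expand[OF n(1)] by simp
qed

lemma inv_form_lt_max:
  assumes n: "norm n = 1" "n \<noteq> e 1" "n \<noteq> - e 1"
  shows "inv_form n < 1 / l 1"
proof -
  have gap: "1 / l 1 - 1 / l 2 > 0" "1 / l 1 - 1 / l 3 > 0"
    using l by (simp_all add: frac_less2)
  have "1 / l 1 * ((n \<bullet> e 1)\<^sup>2 + (n \<bullet> e 2)\<^sup>2 + (n \<bullet> e 3)\<^sup>2) - inv_form n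
      = (1 / l 1 - 1 / l 2) * (n \<bullet> e 2)\<^sup>2 + (1 / l 1 - 1 / l 3) * (n \<bullet> e 3)\<^sup>2"
    by (simp add: inv_form_def algebra_simps)
  moreover have "\<dots> > 0"
  proof (cases "n \<bullet> e 2 = 0")
    case True
    then have "n \<bullet> e 3 \<noteq> 0"
      using unit_eq_e(1)[OF n(1)] n(2,3) by blast
    then show ?thesis
      using gap True by simp
  next
    case False
    then show ?thesis
      using gap by (intro add_pos_nonneg) simp_all
  qed
  ultimately show ?thesis
    using unit_expand[OF n(1)] by simp
qed

text \<open>At \<open>e 3\<close> the repulsion equals \<open>sqrt (l 3)\<close>, which turns the
  threshold for repulsion into \<open>l 3 > 1\<close>. If \<open>n\<close> differed from
  \<open>e 3\<close> up to sign, then \<open>e 3\<close> itself would be a competitor with larger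
  repulsion.\<close>

lemma maximal_repulsion_iff:
  assumes n: "norm n = 1"
  shows "(\<forall>m. norm m = 1 \<and> m \<noteq> n \<and> m \<noteq> - n \<longrightarrow>
      normal_repulsion A m < normal_repulsion A n \<and> normal_repulsion A n > 1) \<longleftrightarrow>
    (e 3 = n \<or> e 3 = - n) \<and> l 3 > 1" (is "?L \<longleftrightarrow> ?R")
proof
  assume L: ?L
  have 3: "e 3 = n \<or> e 3 = - n"
  proof (rule ccontr)
    assume "\<not> (e 3 = n \<or> e 3 = - n)"
    then have "normal_repulsion A (e 3) < normal_repulsion A n" "n \<noteq> e 3" "n \<noteq> - e 3"
      using L norm_e by auto
    then show False
      using inv_form_gt_min[OF n] by (simp add: normal_repulsion_less_iff n norm_e inv_form_e)
  qed
  then have "n = e 3 \<or> n = - e 3"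
    by auto
  \<comment> \<open>The threshold stands under the quantifier over \<open>m\<close>;
    \<open>e 1\<close> is an admissible \<open>m\<close> that releases it.\<close>
  then have "e 1 \<bullet> n = 0"
    by auto
  then have "e 1 \<noteq> n \<and> e 1 \<noteq> - n"
    using n by (auto simp: norm_eq_1)
  then have "inv_form n < 1"
    using L norm_e n normal_repulsion_gt_1_iff by blast
  then have "1 / l 3 < 1"
    using 3 inv_form_e inv_form_minus[of n] by auto
  then show ?R
    using 3 l_pos by simp
next
  assume R: ?R
  then have n3: "n = e 3 \<or> n = - e 3"
    by auto
  then have Q: "inv_form n = 1 / l 3"
    by (auto simp: inv_form_e inv_form_minus)
  have "1 / l 3 < 1"
    using R by simp
  moreover have "inv_form m > 1 / l 3" if "norm m = 1" "m \<noteq> n" "m \<noteq> - n" for m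
    using n3 that by (intro inv_form_gt_min) auto
  ultimately show ?L
    by (simp add: normal_repulsion_less_iff normal_repulsion_gt_1_iff n Q)
qed

text \<open>Mirror image of \<open>maximal_repulsion_iff\<close>: the repulsion at
  \<open>e 1\<close> is \<open>sqrt (l 1)\<close>, and \<open>e 3\<close> is the admissible vector
  that releases the threshold.\<close>

lemma minimal_repulsion_iff:
  assumes n: "norm n = 1"
  shows "(\<forall>m. norm m = 1 \<and> m \<noteq> n \<and> m \<noteq> - n \<longrightarrow>
      normal_repulsion A m > normal_repulsion A n \<and> normal_repulsion A n < 1) \<longleftrightarrow>
    (e 1 = n \<or> e 1 = - n) \<and> l 1 < 1" (is "?L \<longleftrightarrow> ?R")
proof
  assume L: ?L
  have 1: "e 1 = n \<or> e 1 = - n"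
  proof (rule ccontr)
    assume "\<not> (e 1 = n \<or> e 1 = - n)"
    then have "normal_repulsion A n < normal_repulsion A (e 1)" "n \<noteq> e 1" "n \<noteq> - e 1"
      using L norm_e by auto
    then show False
      using inv_form_lt_max[OF n] normal_repulsion_less_iff[OF norm_e(1) n] inv_form_e by auto
  qed
  then have "n = e 1 \<or> n = - e 1"
    by auto
  then have "e 3 \<bullet> n = 0"
    by auto
  then have "e 3 \<noteq> n \<and> e 3 \<noteq> - n"
    using n by (auto simp: norm_eq_1)
  then have "inv_form n > 1"
    using L norm_e n normal_repulsion_lt_1_iff by blast
  then have "1 / l 1 > 1"
    using 1 inv_form_e inv_form_minus[of n] by auto
  then show ?R
    using 1 l_pos by simp
next
  assume R: ?R
  then have n1: "n = e 1 \<or> n = - e 1"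
    by auto
  then have Q: "inv_form n = 1 / l 1"
    by (auto simp: inv_form_e inv_form_minus)
  have "1 / l 1 > 1"
    using R l_pos by simp
  moreover have "inv_form m < 1 / l 1" if "norm m = 1" "m \<noteq> n" "m \<noteq> - n" for m
    using n1 that by (intro inv_form_lt_max) auto
  ultimately show ?L
    by (simp add: normal_repulsion_less_iff normal_repulsion_lt_1_iff n Q)
qed

section \<open>Maximum of the tangential shear\<close>

lemma shear_normal_inner:
  "shear_normal s l e \<bullet> e 1 = sqrt (sqrt (l 1) / (sqrt (l 1) + sqrt (l 3)))"
  "shear_normal s l e \<bullet> e 2 = 0"
  "shear_normal s l e \<bullet> e 3 = s * sqrt (sqrt (l 3) / (sqrt (l 1) + sqrt (l 3)))"
  by (simp_all add: shear_normal_def inner_add_left)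

lemma shear_normal_inner_sq:
  assumes "s \<in> {1, -1}"
  shows "(shear_normal s l e \<bullet> e 1)\<^sup>2 = sqrt (l 1) / (sqrt (l 1) + sqrt (l 3))"
    and "(shear_normal s l e \<bullet> e 3)\<^sup>2 = sqrt (l 3) / (sqrt (l 1) + sqrt (l 3))"
  unfolding shear_normal_inner using assms l_pos by (auto simp: power_mult_distrib)

lemma norm_shear_normal:
  assumes "s \<in> {1, -1}"
  shows "norm (shear_normal s l e) = 1"
proof -
  have "sqrt (l 1) + sqrt (l 3) > 0"
    using l_pos by (simp add: add_pos_pos)
  then have "sqrt (l 1) / (sqrt (l 1) + sqrt (l 3)) + sqrt (l 3) / (sqrt (l 1) + sqrt (l 3)) = 1"
    by (simp flip: add_divide_distrib)
  then have "shear_normal s l e \<bullet> shear_normal s l e = 1"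
    using inner_expand[of "shear_normal s l e" "shear_normal s l e"] shear_normal_inner(2)[of s]
      shear_normal_inner_sq[OF assms] by (simp add: power2_eq_square)
  then show ?thesis
    by (simp add: norm_eq_1)
qed

text \<open>Termwise, \<open>(\<lambda> - \<lambda>\<^sub>1) (\<lambda>\<^sub>3 - \<lambda>) \<ge> 0\<close> bounds \<open>\<lambda> + \<lambda>\<^sub>1 \<lambda>\<^sub>3 / \<lambda>\<close> by \<open>\<lambda>\<^sub>1 + \<lambda>\<^sub>3\<close>;
  then AM-GM applies to \<open>\<lambda>\<^sub>1 \<lambda>\<^sub>3 q + 1 / q\<close> with \<open>q\<close> the inverse form.\<close>

lemma shear_deficit:
  assumes n: "norm n = 1"
  shows "(tangential_shear A n)\<^sup>2 = (sqrt (l 3) - sqrt (l 1))\<^sup>2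
    - (l 2 - l 1) * (l 3 - l 2) / l 2 * (n \<bullet> e 2)\<^sup>2
    - (sqrt (l 1) * sqrt (l 3) * inv_form n - 1)\<^sup>2 / inv_form n"
proof -
  define a b c where "a = (n \<bullet> e 1)\<^sup>2" and "b = (n \<bullet> e 2)\<^sup>2" and "c = (n \<bullet> e 3)\<^sup>2"
  define p r where "p = sqrt (l 1)" and "r = sqrt (l 3)"
  define q where "q = inv_form n"
  have pr: "l 1 = p\<^sup>2" "l 3 = r\<^sup>2" "p > 0" "r > 0"
    using l_pos by (simp_all add: p_def r_def)
  have q0: "q > 0"
    using inv_form_pos[OF n] by (simp add: q_def)
  have q: "q = a / p\<^sup>2 + b / l 2 + c / r\<^sup>2"
    by (simp add: q_def inv_form_def a_def b_def c_def pr)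
  have abc: "a = 1 - b - c"
    using unit_expand[OF n] by (simp add: a_def b_def c_def)
  have "(tangential_shear A n)\<^sup>2 = p\<^sup>2 * a + l 2 * b + r\<^sup>2 * c - 1 / q"
  proof -
    have "tangential_shear A n \<ge> 0"
      by (simp add: tangential_shear_def)
    then show ?thesis
      using tangential_shear_eq[OF n]
      by (metis a_def b_def c_def pr(1,2) q_def real_sqrt_ge_0_iff real_sqrt_pow2)
  qed
  moreover have "p\<^sup>2 * a + l 2 * b + r\<^sup>2 * c = p\<^sup>2 + r\<^sup>2 - p\<^sup>2 * r\<^sup>2 * q - (l 2 - p\<^sup>2) * (r\<^sup>2 - l 2) / l 2 * b"
  proof -
    have pq: "p\<^sup>2 * r\<^sup>2 * q = r\<^sup>2 * a + p\<^sup>2 * r\<^sup>2 / l 2 * b + p\<^sup>2 * c"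
      using pr by (simp add: q field_simps)
    have gap: "(l 2 - p\<^sup>2) * (r\<^sup>2 - l 2) / l 2 = r\<^sup>2 - l 2 - p\<^sup>2 * r\<^sup>2 / l 2 + p\<^sup>2"
      using l_pos(2) by (simp add: field_simps power2_eq_square)
    show ?thesis
      unfolding pq gap abc by (simp add: algebra_simps)
  qed
  \<comment> \<open>The exact form of AM-GM: the square divided by \<open>q\<close> is the excess of
    the sum over \<open>2 * p * r\<close>, which completes \<open>(r - p)^2\<close>.\<close>
  moreover have "(p * r * q - 1)\<^sup>2 / q = p\<^sup>2 * r\<^sup>2 * q - 2 * p * r + 1 / q"
    using q0 by (simp add: field_simps power2_eq_square)
  moreover have "(r - p)\<^sup>2 = p\<^sup>2 + r\<^sup>2 - 2 * p * r"
    by (simp add: power2_diff)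
  ultimately have "(tangential_shear A n)\<^sup>2 =
      (r - p)\<^sup>2 - (l 2 - p\<^sup>2) * (r\<^sup>2 - l 2) / l 2 * b - (p * r * q - 1)\<^sup>2 / q"
    by simp
  then show ?thesis
    unfolding pr(1,2)[symmetric] unfolding p_def r_def q_def b_def .
qed

lemma tangential_shear_le_max:
  assumes n: "norm n = 1"
  shows "tangential_shear A n \<le> sqrt (l 3) - sqrt (l 1)"
proof -
  have "(l 2 - l 1) * (l 3 - l 2) / l 2 * (n \<bullet> e 2)\<^sup>2 \<ge> 0"
    using l l_pos by simp
  moreover have "(sqrt (l 1) * sqrt (l 3) * inv_form n - 1)\<^sup>2 / inv_form n \<ge> 0"
    using inv_form_pos[OF n] by simp
  ultimately have "(tangential_shear A n)\<^sup>2 \<le> (sqrt (l 3) - sqrt (l 1))\<^sup>2"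
    unfolding shear_deficit[OF n] by linarith
  then show ?thesis
    using l by (simp add: power2_le_iff_abs_le)
qed

text \<open>Both terms subtracted in \<open>shear_deficit\<close> vanish: there is no
  \<open>e 2\<close> component, and the inverse form equals
  \<open>1 / (sqrt (l 1) * sqrt (l 3))\<close>.\<close>

lemma tangential_shear_shear_normal:
  assumes s: "s \<in> {1, -1}"
  shows "tangential_shear A (shear_normal s l e) = sqrt (l 3) - sqrt (l 1)"
proof -
  define p r where "p = sqrt (l 1)" and "r = sqrt (l 3)"
  have pr: "l 1 = p\<^sup>2" "l 3 = r\<^sup>2" "p > 0" "r > 0"
    using l_pos by (simp_all add: p_def r_def)
  have "p + r \<noteq> 0"
    using pr by linarith
  have "inv_form (shear_normal s l e) = p / (p + r) / p\<^sup>2 + r / (p + r) / r\<^sup>2"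
    unfolding inv_form_def shear_normal_inner_sq[OF s] shear_normal_inner(2)
      p_def[symmetric] r_def[symmetric]
    by (simp add: pr(1,2))
  also have "\<dots> = 1 / (p * r)"
    using pr(3,4) \<open>p + r \<noteq> 0\<close> by (simp add: divide_simps power2_eq_square)
  finally have "sqrt (l 1) * sqrt (l 3) * inv_form (shear_normal s l e) = 1"
    using pr by (simp flip: p_def r_def)
  then have "(tangential_shear A (shear_normal s l e))\<^sup>2 = (sqrt (l 3) - sqrt (l 1))\<^sup>2"
    unfolding shear_deficit[OF norm_shear_normal[OF s]] shear_normal_inner(2) by simp
  moreover have "tangential_shear A (shear_normal s l e) \<ge> 0"
    by (simp add: tangential_shear_def)
  ultimately show ?thesis
    using l by simp
qed

text \<open>At the maximum both nonnegative deficits must vanish. This removes the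
  \<open>e 2\<close> component and fixes the inverse form; together with unit length it determines
  the squares of the two other components, so only their signs stay free.\<close>

lemma tangential_shear_max_imp:
  assumes n: "norm n = 1" and max: "tangential_shear A n = sqrt (l 3) - sqrt (l 1)"
  shows "\<exists>s\<in>{1, -1}. shear_normal s l e = n \<or> shear_normal s l e = - n"
proof -
  have "(l 2 - l 1) * (l 3 - l 2) / l 2 * (n \<bullet> e 2)\<^sup>2 \<ge> 0"
    using l l_pos by simp
  moreover have "(sqrt (l 1) * sqrt (l 3) * inv_form n - 1)\<^sup>2 / inv_form n \<ge> 0"
    using inv_form_pos[OF n] by simp
  ultimately have "(l 2 - l 1) * (l 3 - l 2) / l 2 * (n \<bullet> e 2)\<^sup>2 = 0"
    and "(sqrt (l 1) * sqrt (l 3) * inv_form n - 1)\<^sup>2 / inv_form n = 0"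
    using shear_deficit[OF n] unfolding max by linarith+
  then have n2: "n \<bullet> e 2 = 0" and q: "sqrt (l 1) * sqrt (l 3) * inv_form n = 1"
    using l l_pos inv_form_pos[OF n] by simp_all
  define a c where "a = (n \<bullet> e 1)\<^sup>2" and "c = (n \<bullet> e 3)\<^sup>2"
  define p r where "p = sqrt (l 1)" and "r = sqrt (l 3)"
  have pr: "l 1 = p\<^sup>2" "l 3 = r\<^sup>2" "p > 0" "r > 0" "p < r"
    using l l_pos by (simp_all add: p_def r_def)
  have ac: "c = 1 - a"
    using unit_expand[OF n] n2 by (simp add: a_def c_def)
  have "p * r * (a / p\<^sup>2 + c / r\<^sup>2) = 1"
    using q n2 by (simp add: inv_form_def a_def c_def p_def r_def l_pos less_imp_le)
  moreover have "p * r * (a / p\<^sup>2 + c / r\<^sup>2) = (r\<^sup>2 * a + p\<^sup>2 * c) / (p * r)"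
    using pr(3,4) by (simp add: divide_simps power2_eq_square)
  ultimately have "r\<^sup>2 * a + p\<^sup>2 * c = p * r"
    using pr(3,4) by simp
  \<comment> \<open>Substituting \<open>c = 1 - a\<close> makes the equation factor;
    \<open>r - p\<close> cancels because \<open>l 1 < l 3\<close>.\<close>
  then have "(r - p) * ((p + r) * a - p) = 0"
    unfolding ac by (simp add: algebra_simps power2_eq_square)
  then have "(p + r) * a = p"
    using pr by simp
  moreover have "p + r > 0"
    using pr by simp
  ultimately have a: "a = p / (p + r)" and c: "c = r / (p + r)"
    unfolding ac by (simp_all add: field_simps)
  define \<alpha> \<beta> where "\<alpha> = sqrt (p / (p + r))" and "\<beta> = sqrt (r / (p + r))"
  have "\<alpha>\<^sup>2 = (n \<bullet> e 1)\<^sup>2" "\<beta>\<^sup>2 = (n \<bullet> e 3)\<^sup>2"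
    using a c pr by (simp_all add: \<alpha>_def \<beta>_def a_def c_def)
  then have "(n \<bullet> e 1 = \<alpha> \<or> n \<bullet> e 1 = - \<alpha>) \<and> (n \<bullet> e 3 = \<beta> \<or> n \<bullet> e 3 = - \<beta>)"
    by (metis power2_eq_iff)
  moreover have "n = (n \<bullet> e 1) *\<^sub>R e 1 + (n \<bullet> e 3) *\<^sub>R e 3"
    using expand[of n] n2 by simp
  \<comment> \<open>Four choices of signs: up to an overall sign they are the two shear
    normals.\<close>
  ultimately have "n \<in> {\<alpha> *\<^sub>R e 1 + \<beta> *\<^sub>R e 3, \<alpha> *\<^sub>R e 1 - \<beta> *\<^sub>R e 3,
      - (\<alpha> *\<^sub>R e 1 + \<beta> *\<^sub>R e 3), - (\<alpha> *\<^sub>R e 1 - \<beta> *\<^sub>R e 3)}"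
    by auto
  moreover have "shear_normal 1 l e = \<alpha> *\<^sub>R e 1 + \<beta> *\<^sub>R e 3"
    "shear_normal (-1) l e = \<alpha> *\<^sub>R e 1 - \<beta> *\<^sub>R e 3"
    by (simp_all add: shear_normal_def \<alpha>_def \<beta>_def p_def r_def)
  ultimately show ?thesis
    by force
qed

lemma tangential_shear_minus: "norm n = 1 \<Longrightarrow> tangential_shear A (- n) = tangential_shear A n"
  using tangential_shear_eq[of n] tangential_shear_eq[of "- n"] by (simp add: inv_form_minus)

text \<open>Recovers the sign \<open>s\<close> from the vector. The product of the components along
  \<open>e 1\<close> and \<open>e 3\<close> is quadratic, so its sign survives any nonzero
  rescaling, in particular a reversal of the normal.\<close>

lemma shear_normal_inner_pos:
  assumes "s \<in> {1, -1}"
  shows "s * ((shear_normal s l e \<bullet> e 1) * (shear_normal s l e \<bullet> e 3)) > 0"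
proof -
  have "sqrt (l 1) + sqrt (l 3) > 0"
    using l_pos by (simp add: add_pos_pos)
  then have "sqrt (l 1) / (sqrt (l 1) + sqrt (l 3)) > 0" "sqrt (l 3) / (sqrt (l 1) + sqrt (l 3)) > 0"
    using l_pos by simp_all
  then show ?thesis
    unfolding shear_normal_inner using assms by (auto simp only: real_sqrt_gt_0_iff mult_pos_pos
        minus_mult_minus mult_minus_left mult_minus_right mult_1_left minus_minus)
qed

lemma maximal_shear_iff:
  assumes n: "norm n = 1"
  shows "(\<forall>m. norm m = 1 \<and> m \<noteq> n \<and> m \<noteq> - n \<longrightarrow> tangential_shear A m \<le> tangential_shear A n) \<longleftrightarrow>
    (\<exists>s\<in>{1, -1}. shear_normal s l e = n \<or> shear_normal s l e = - n)" (is "?L \<longleftrightarrow> ?R")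
proof
  assume L: ?L
  show ?R
  proof (rule tangential_shear_max_imp[OF n], rule antisym[OF tangential_shear_le_max[OF n]])
    let ?m = "shear_normal 1 l e"
    show "sqrt (l 3) - sqrt (l 1) \<le> tangential_shear A n"
    \<comment> \<open>\<open>?m\<close> attains the maximum but is an admissible competitor only if
      it differs from \<open>n\<close> and \<open>- n\<close>; otherwise evenness of the shear gives
      the value at \<open>n\<close> directly.\<close>
    proof (cases "?m = n \<or> ?m = - n")
      case True
      then show ?thesis
        using tangential_shear_shear_normal[of 1] tangential_shear_minus[OF n] by auto
    next
      case False
      then show ?thesis
        using L norm_shear_normal[of 1] tangential_shear_shear_normal[of 1] by auto
    qed
  qed
next
  assume ?R
  then have "tangential_shear A n = sqrt (l 3) - sqrt (l 1)"
    using tangential_shear_shear_normal tangential_shear_minus[OF n] by force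
  then show ?L
    using tangential_shear_le_max by simp
qed

end

section \<open>From pointwise extrema to conditions on the whole surface\<close>

text \<open>A unit normal exists, so the quantifier is not vacuous and a criterion \<open>Q\<close>
  that does not mention the normal can be pulled out of it.\<close>

lemma all_unit_normals_iff:
  assumes "smooth_surface S" "p \<in> S" "\<And>n. unit_normal S p n \<Longrightarrow> R n \<longleftrightarrow> Q"
  shows "(\<forall>n. unit_normal S p n \<longrightarrow> R n) \<longleftrightarrow> Q"
proof -
  obtain n where "unit_normal S p n"
    using smooth_surface_unit_normal[OF assms(1,2)] by blast
  then show ?thesis
    using assms(3) by blast
qed

text \<open>With \<open>\<nu>\<close> a local normal field, the sign at \<open>x\<close> is that of \<open>(\<nu> \<bullet> \<xi>\<^sub>1) (\<nu> \<bullet> \<xi>\<^sub>3)\<close>.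
  Hence it is locally constant without any continuity of the eigenvalues.\<close>

lemma shear_normal_sign_constant:
  fixes S :: "(real^3) set" and lam :: "real^3 \<Rightarrow> nat \<Rightarrow> real" and \<xi> :: "real^3 \<Rightarrow> nat \<Rightarrow> real^3"
  assumes S: "smooth_surface S" "connected S"
    and strain: "\<And>x. x \<in> S \<Longrightarrow> strain (A x) (lam x) (\<xi> x)"
    and cont: "continuous_on S (\<lambda>x. \<xi> x 1)" "continuous_on S (\<lambda>x. \<xi> x 3)"
    and perp: "\<And>x. x \<in> S \<Longrightarrow> \<exists>s\<in>{1,-1}. perp_tangent S x (shear_normal s (lam x) (\<xi> x))"
  shows "\<exists>s\<in>{1,-1}. \<forall>x\<in>S. perp_tangent S x (shear_normal s (lam x) (\<xi> x))"
proof -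
  define f where "f x \<longleftrightarrow> perp_tangent S x (shear_normal 1 (lam x) (\<xi> x))" for x
  have loc: "\<forall>\<^sub>F x in at p within S. f p = f x" if p: "p \<in> S" for p
  proof -
    obtain U \<nu> where U: "open U" "p \<in> U" and \<nu>: "continuous_on U \<nu>"
      and "\<And>x. x \<in> S \<inter> U \<Longrightarrow> \<nu> x \<noteq> 0"
      and normal: "\<And>x m. x \<in> S \<inter> U \<Longrightarrow> perp_tangent S x m \<longleftrightarrow> (\<exists>c. m = c *\<^sub>R \<nu> x)"
      by (rule smooth_surface_local_normal[OF S(1) p]) (rule that)
    define g where "g x = (\<nu> x \<bullet> \<xi> x 1) * (\<nu> x \<bullet> \<xi> x 3)" for x
    have sign: "s * g x > 0"
      if x: "x \<in> S \<inter> U" and s: "s \<in> {1,-1}" "perp_tangent S x (shear_normal s (lam x) (\<xi> x))" for x s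
    proof -
      obtain c where "shear_normal s (lam x) (\<xi> x) = c *\<^sub>R \<nu> x"
        using normal[OF x] s(2) by blast
      \<comment> \<open>Passing from the shear normal to \<nu> only contributes the square of the
        factor \<open>c\<close>, so \<open>g x\<close> has the sign \<open>s\<close>.\<close>
      then have "c\<^sup>2 * (s * g x) > 0"
        using strain.shear_normal_inner_pos[OF strain s(1), of x] x
        by (simp add: g_def power2_eq_square mult_ac)
      then show ?thesis
        by (simp add: zero_less_mult_iff)
    qed
    have f_iff: "f x \<longleftrightarrow> g x > 0" and g_nz: "g x \<noteq> 0" if x: "x \<in> S \<inter> U" for x
    proof -
      have "g x > 0" if "f x"
        using sign[OF x, of 1] that by (simp add: f_def)
      moreover have "g x < 0" if "\<not> f x"
        using sign[OF x, of "-1"] perp[of x] x that by (auto simp: f_def)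
      ultimately show "f x \<longleftrightarrow> g x > 0" "g x \<noteq> 0"
        by fastforce+
    qed
    have "continuous_on (S \<inter> U) g"
      unfolding g_def using cont \<nu> by (intro continuous_intros) (auto intro: continuous_on_subset)
    then have lim: "(g \<longlongrightarrow> g p) (at p within S \<inter> U)"
      using p U(2) by (simp add: continuous_on_def)
    have pU: "p \<in> S \<inter> U"
      using p U(2) by blast
    have "\<forall>\<^sub>F x in at p within S \<inter> U. f p = f x"
    proof (cases "g p > 0")
      case True
      then have "\<forall>\<^sub>F x in at p within S \<inter> U. g x > 0"
        using order_tendstoD(1)[OF lim] by blast
      moreover have "\<forall>\<^sub>F x in at p within S \<inter> U. x \<in> S \<inter> U"
        by (simp add: eventually_at_filter)
      ultimately show ?thesis
        by eventually_elim (use f_iff[OF pU] f_iff True in blast)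
    next
      case False
      then have "\<forall>\<^sub>F x in at p within S \<inter> U. g x < 0"
        using order_tendstoD(2)[OF lim] g_nz[OF pU] by simp
      moreover have "\<forall>\<^sub>F x in at p within S \<inter> U. x \<in> S \<inter> U"
        by (simp add: eventually_at_filter)
      ultimately show ?thesis
      proof eventually_elim
        case (elim x)
        then show ?case
          using f_iff[OF pU] f_iff[of x] False by auto
      qed
    qed
    moreover have "at p within S \<inter> U = at p within S"
      by (rule at_within_nhd[OF U(2,1)]) blast
    ultimately show ?thesis
      by simp
  qed
  have const: "f x = f y" if "x \<in> S" "y \<in> S" for x y
    using connected_local_const[OF S(2) that] loc by blast
  show ?thesis
  proof (cases "\<exists>x\<in>S. f x")
    case True
    then show ?thesis
      using const unfolding f_def by blast
  next
    case False
    then have "\<forall>x\<in>S. perp_tangent S x (shear_normal (-1) (lam x) (\<xi> x))"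
      using perp unfolding f_def by blast
    then show ?thesis
      by blast
  qed
qed

text \<open>The standing restriction to the set U enters as \<open>M_restricted\<close>. The
  definitions of hyperbolic structures contain thresholds for the repulsion, and these become
  \<open>lam x0 3 > 1\<close> and \<open>lam x0 1 < 1\<close>. Eigenvectors carry an arbitrary
  orientation at each point, and reversing \<xi>\<open>\<^sub>1\<close> exchanges the two shear
  normals up to sign; hence the sign is first chosen pointwise. The last clause gives one sign for
  the whole surface when it is connected and the two eigenvector fields are continuous on
  it.\<close>

theorem theorem1:
  fixes v :: "real^3 \<Rightarrow> real \<Rightarrow> real^3" and G :: "((real^3) \<times> real) set"
    and D W :: "(real^3) set" and t0 T :: real
    and lam :: "real^3 \<Rightarrow> nat \<Rightarrow> real" and \<xi> :: "real^3 \<Rightarrow> nat \<Rightarrow> real^3"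
    and M :: "real \<Rightarrow> (real^3) set"
  assumes T_pos: "0 < T"
    and D_compact: "compact D"
    and v_smooth: "D \<times> {t0..t0+T} \<subseteq> G" "smooth_on G (\<lambda>(x, t). v x t)"
    and flow_exists: "open W" "D \<subseteq> W" "\<And>x0. x0 \<in> W \<Longrightarrow> \<exists>x. trajectory v G t0 T x0 x"
    and eigen: "\<And>x0. x0 \<in> D \<Longrightarrow> ordered_eigensystem (cauchy_green v G t0 T x0) (lam x0) (\<xi> x0)"
    and M_surface: "material_surface v G W t0 T M"
    and M_restricted: "M t0 \<subseteq> distinct_strain_set D lam"
  shows
    "(repelling_LCS v G W t0 T M \<longleftrightarrow>
       M t0 \<subseteq> distinct_strain_set D lam \<and>
       (\<forall>x0\<in>M t0. perp_tangent (M t0) x0 (\<xi> x0 3)) \<and>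
       (\<forall>x0\<in>M t0. lam x0 3 > 1)) \<and>
     (attracting_LCS v G W t0 T M \<longleftrightarrow>
       M t0 \<subseteq> distinct_strain_set D lam \<and>
       (\<forall>x0\<in>M t0. perp_tangent (M t0) x0 (\<xi> x0 1)) \<and>
       (\<forall>x0\<in>M t0. lam x0 1 < 1)) \<and>
     (shear_LCS v G W t0 T M \<longleftrightarrow>
       M t0 \<subseteq> distinct_strain_set D lam \<and>
       (\<forall>x0\<in>M t0. \<exists>s\<in>{1,-1}. perp_tangent (M t0) x0 (shear_normal s (lam x0) (\<xi> x0)))) \<and>
     (connected (M t0) \<and> continuous_on (M t0) (\<lambda>x0. \<xi> x0 1) \<and> continuous_on (M t0) (\<lambda>x0. \<xi> x0 3) \<longrightarrow>
      (shear_LCS v G W t0 T M \<longleftrightarrow>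
       M t0 \<subseteq> distinct_strain_set D lam \<and>
       (\<exists>s\<in>{1,-1}. \<forall>x0\<in>M t0. perp_tangent (M t0) x0 (shear_normal s (lam x0) (\<xi> x0)))))"
proof -
  have S: "smooth_surface (M t0)"
    using M_surface by (simp add: material_surface_def)
  have strain: "strain (flow_gradient v G t0 T x) (lam x) (\<xi> x)" if "x \<in> M t0" for x
  proof -
    have "x \<in> D" "0 < lam x 1" "lam x 1 < lam x 2" "lam x 2 < lam x 3"
      using M_restricted that by (auto simp: distinct_strain_set_def)
    then show ?thesis
      using eigen[of x] by (simp add: strain_def cauchy_green_def)
  qed
  have compared: "compared_with_others v G W t0 T M P \<longleftrightarrow>
     (\<forall>x\<in>M t0. \<forall>n. unit_normal (M t0) x n \<longrightarrow>
       (\<forall>m. norm m = 1 \<and> m \<noteq> n \<and> m \<noteq> - n \<longrightarrow> P x n m))" for P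
    by (rule compared_with_others_iff[OF flow_exists(1) _ M_surface]) (rule flow_exists(3))
  have rep: "repelling_LCS v G W t0 T M \<longleftrightarrow>
      (\<forall>x\<in>M t0. perp_tangent (M t0) x (\<xi> x 3) \<and> lam x 3 > 1)"
  proof -
    have "(\<forall>n. unit_normal (M t0) x n \<longrightarrow> (\<forall>m. norm m = 1 \<and> m \<noteq> n \<and> m \<noteq> - n \<longrightarrow>
          normal_repulsion (flow_gradient v G t0 T x) m < normal_repulsion (flow_gradient v G t0 T x) n \<and>
          normal_repulsion (flow_gradient v G t0 T x) n > 1)) \<longleftrightarrow>
        perp_tangent (M t0) x (\<xi> x 3) \<and> lam x 3 > 1" if x: "x \<in> M t0" for x
    proof (rule all_unit_normals_iff[OF S x])
      interpret strain "flow_gradient v G t0 T x" "lam x" "\<xi> x"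
        using strain[OF x] .
      fix n assume n: "unit_normal (M t0) x n"
      show "(\<forall>m. norm m = 1 \<and> m \<noteq> n \<and> m \<noteq> - n \<longrightarrow>
          normal_repulsion (flow_gradient v G t0 T x) m < normal_repulsion (flow_gradient v G t0 T x) n \<and>
          normal_repulsion (flow_gradient v G t0 T x) n > 1) \<longleftrightarrow>
        perp_tangent (M t0) x (\<xi> x 3) \<and> lam x 3 > 1"
        \<comment> \<open>The pointwise criterion asks for \<open>e 3\<close> to equal the normal up
          to sign, which \<open>unit_normal_iff_perp_tangent\<close> reads as orthogonality to the
          surface.\<close>
        using maximal_repulsion_iff[of n] unit_normal_iff_perp_tangent[OF S x n norm_e(3)] n
        by (simp add: unit_normal_def)
    qed
    then show ?thesis
      unfolding repelling_LCS_def compared using M_surface by simp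
  qed
  have att: "attracting_LCS v G W t0 T M \<longleftrightarrow>
      (\<forall>x\<in>M t0. perp_tangent (M t0) x (\<xi> x 1) \<and> lam x 1 < 1)"
  proof -
    have "(\<forall>n. unit_normal (M t0) x n \<longrightarrow> (\<forall>m. norm m = 1 \<and> m \<noteq> n \<and> m \<noteq> - n \<longrightarrow>
          normal_repulsion (flow_gradient v G t0 T x) m > normal_repulsion (flow_gradient v G t0 T x) n \<and>
          normal_repulsion (flow_gradient v G t0 T x) n < 1)) \<longleftrightarrow>
        perp_tangent (M t0) x (\<xi> x 1) \<and> lam x 1 < 1" if x: "x \<in> M t0" for x
    proof (rule all_unit_normals_iff[OF S x])
      interpret strain "flow_gradient v G t0 T x" "lam x" "\<xi> x"
        using strain[OF x] .
      fix n assume n: "unit_normal (M t0) x n"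
      show "(\<forall>m. norm m = 1 \<and> m \<noteq> n \<and> m \<noteq> - n \<longrightarrow>
          normal_repulsion (flow_gradient v G t0 T x) m > normal_repulsion (flow_gradient v G t0 T x) n \<and>
          normal_repulsion (flow_gradient v G t0 T x) n < 1) \<longleftrightarrow>
        perp_tangent (M t0) x (\<xi> x 1) \<and> lam x 1 < 1"
        using minimal_repulsion_iff[of n] unit_normal_iff_perp_tangent[OF S x n norm_e(1)] n
        by (simp add: unit_normal_def)
    qed
    then show ?thesis
      unfolding attracting_LCS_def compared using M_surface by simp
  qed
  have shear: "shear_LCS v G W t0 T M \<longleftrightarrow>
      (\<forall>x\<in>M t0. \<exists>s\<in>{1,-1}. perp_tangent (M t0) x (shear_normal s (lam x) (\<xi> x)))"
  proof -
    have "(\<forall>n. unit_normal (M t0) x n \<longrightarrow> (\<forall>m. norm m = 1 \<and> m \<noteq> n \<and> m \<noteq> - n \<longrightarrow>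
          tangential_shear (flow_gradient v G t0 T x) m \<le> tangential_shear (flow_gradient v G t0 T x) n)) \<longleftrightarrow>
        (\<exists>s\<in>{1,-1}. perp_tangent (M t0) x (shear_normal s (lam x) (\<xi> x)))" if x: "x \<in> M t0" for x
    proof (rule all_unit_normals_iff[OF S x])
      interpret strain "flow_gradient v G t0 T x" "lam x" "\<xi> x"
        using strain[OF x] .
      fix n assume n: "unit_normal (M t0) x n"
      show "(\<forall>m. norm m = 1 \<and> m \<noteq> n \<and> m \<noteq> - n \<longrightarrow>
          tangential_shear (flow_gradient v G t0 T x) m \<le> tangential_shear (flow_gradient v G t0 T x) n) \<longleftrightarrow>
        (\<exists>s\<in>{1,-1}. perp_tangent (M t0) x (shear_normal s (lam x) (\<xi> x)))"
        using maximal_shear_iff[of n] unit_normal_iff_perp_tangent[OF S x n norm_shear_normal] n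
        by (simp add: unit_normal_def)
    qed
    then show ?thesis
      unfolding shear_LCS_def compared using M_surface by simp
  qed
  have sign: "(\<forall>x\<in>M t0. \<exists>s\<in>{1,-1}. perp_tangent (M t0) x (shear_normal s (lam x) (\<xi> x))) \<longleftrightarrow>
      (\<exists>s\<in>{1,-1}. \<forall>x\<in>M t0. perp_tangent (M t0) x (shear_normal s (lam x) (\<xi> x)))"
    if "connected (M t0)" "continuous_on (M t0) (\<lambda>x. \<xi> x 1)" "continuous_on (M t0) (\<lambda>x. \<xi> x 3)"
    using shear_normal_sign_constant[OF S that(1) strain that(2,3)] by blast
  show ?thesis
    unfolding rep att shear using M_restricted sign by blast
qed

end
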